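(* Let $m,n\ge 1$, let $x^i\in\mathbb{R}^n$ and $y^i\in\{-1,1\}$ for $i=1,\dots,m$, let $\bar\alpha\in\mathbb{R}^m$ be a fixed vector, let $\gamma>0$ and $c\ge 0$ be real, let $d\ge 2$ be an integer, and let $B\in\{1,\dots,n\}$. Define $$\lambda=\sum_{i=1}^m\sum_{h=1}^m\bar\alpha_i\bar\alpha_h y^iy^h\Bigl(c+\sum_{j\in[n]}\gamma x^i_jx^h_j\Bigr)^d,$$ and, for every $S\subseteq[n]$, $$H(S)=\lambda-\sum_{i=1}^m\sum_{h=1}^m\bar\alpha_i\bar\alpha_h y^iy^h\Bigl(c+\sum_{j\in[n]\setminus S}\gamma x^i_jx^h_j\Bigr)^d.$$ Let $F:2^{[n]}\to\mathbb{R}$ be given by $F(\emptyset)=0$ and $$F(S)=\sum_{i=1}^m\sum_{h=1}^m\bar\alpha_i\bar\alpha_h y^iy^h\Bigl(c+\sum_{j\in S}\gamma x^i_jx^h_j\Bigr)^d\qquad\text{for } \emptyset\ne S\subseteq[n].$$ Consider the two problems $$(\mathrm{P}_{\max})\quad \max\{H(S): S\subseteq[n],\ |S|\le n-B\},\qquad (\mathrm{P}_{\min})\quad \min\{F(S): S\subseteq[n],\ |S|=B\}.$$ Then $H$ is a monotone nondecreasing and nonnegative submodular function. Moreover, $(\mathrm{P}_{\max})$ and $(\mathrm{P}_{\min})$ are equivalent in the sense that, given an optimal solution $S''$ of $(\mathrm{P}_{\max})$ with value $H(S'')$, we can obtain an optimal solution $S'$ of $(\mathrm{P}_{\min})$ as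 $S'=[n]\setminus S''$, with value $F(S')=\lambda-H(S'')$.
   Context: Notation: $[n]=\{1,\dots,n\}$; $x^i_j$ is the $j$-th component of $x^i$. A set function $f:2^E\to\mathbb{R}$ on a finite set $E$ is submodular if $f(S)+f(T)\ge f(S\cup T)+f(S\cap T)$ for all $S,T\subseteq E$; equivalently, $f(T\cup\{e\})-f(T)\ge f(S\cup\{e\})-f(S)$ for all $T\subseteq S\subseteq E$ and $e\in E\setminus S$. It is monotone nondecreasing if $f(S)\le f(S\cup\{e\})$ for all $S\subseteq E$, $e\in E\setminus S$, and nonnegative if $f(S)\ge 0$ for all $S\subseteq E$. The vectors $x^i$ are feature vectors, the $y^i$ are labels, and $B$ is the number of features to be selected.
   Formalization: Optimality of [n]\S'' for (P_min) is claimed only if |S''| = n−B (else it is infeasible, e.g. ᾱ=0, n=2, B=1, S''=∅); instead, every optimal S'' is shown to extend to an optimal T with |T| = n−B, and [n]\T is optimal for (P_min) with value λ−H(S''). *)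

theory Defs
  imports Complex_Main
begin

definition submodular_on :: "'a set \<Rightarrow> ('a set \<Rightarrow> real) \<Rightarrow> bool" where
  "submodular_on E f \<longleftrightarrow>
     (\<forall>S T. S \<subseteq> E \<and> T \<subseteq> E \<longrightarrow> f S + f T \<ge> f (S \<union> T) + f (S \<inter> T))"

definition monotone_nondecreasing_on :: "'a set \<Rightarrow> ('a set \<Rightarrow> real) \<Rightarrow> bool" where
  "monotone_nondecreasing_on E f \<longleftrightarrow>
     (\<forall>S e. S \<subseteq> E \<and> e \<in> E - S \<longrightarrow> f S \<le> f (S \<union> {e}))"

definition nonnegative_on :: "'a set \<Rightarrow> ('a set \<Rightarrow> real) \<Rightarrow> bool" where
  "nonnegative_on E f \<longleftrightarrow> (\<forall>S. S \<subseteq> E \<longrightarrow> f S \<ge> 0)"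

text \<open>
  The feasible sets of the two problems. An optimal solution is expressed with the library
  predicates \<^const>\<open>is_arg_max\<close> and \<^const>\<open>is_arg_min\<close>, which include feasibility.
  The truncated subtraction is harmless, since \<open>B \<le> n\<close> wherever these are used.
\<close>

definition feasible_max :: "nat \<Rightarrow> nat \<Rightarrow> nat set \<Rightarrow> bool" where
  "feasible_max n B S \<longleftrightarrow> S \<subseteq> {1..n} \<and> card S \<le> n - B"

definition feasible_min :: "nat \<Rightarrow> nat \<Rightarrow> nat set \<Rightarrow> bool" where
  "feasible_min n B S \<longleftrightarrow> S \<subseteq> {1..n} \<and> card S = B"

end

theory Submission
  imports Defs "HOL-Library.FuncSet"
begin

text \<open>
  The kernel matrix restricted to the features in \<open>S\<close> is, up to the constant \<open>c\<close>, a sum of rank-one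
  matrices, one for each feature. Expanding the entrywise \<open>d\<close>-th power writes the quadratic form as
  a sum of squares indexed by the words of length \<open>d\<close> over \<open>S \<union> {0}\<close>, where the letter \<open>0\<close> stands for
  \<open>c\<close>. A sum of nonnegative weights over the words with all letters in \<open>S \<union> {0}\<close> is monotone and
  supermodular in \<open>S\<close>; complementing and negating makes \<open>H\<close> monotone and submodular.
\<close>

text \<open>Distributivity turns the \<open>d\<close>-th power into a sum over words of length
  \<open>d\<close>. The summand of a word \<open>w\<close> splits into a factor depending on
  \<open>i\<close> only and the same factor at \<open>h\<close>, so after exchanging sums the double
  sum over \<open>i\<close> and \<open>h\<close> is a perfect square.\<close>

lemma quadratic_form_power_eq_sum_squares:
  fixes a :: "'i \<Rightarrow> real" and \<phi> :: "'j \<Rightarrow> 'i \<Rightarrow> real"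
  assumes "finite A"
  shows "(\<Sum>i\<in>I. \<Sum>h\<in>I. a i * a h * (\<Sum>j\<in>A. \<phi> j i * \<phi> j h) ^ d)
    = (\<Sum>w\<in>{..<d} \<rightarrow>\<^sub>E A. (\<Sum>i\<in>I. a i * (\<Prod>k<d. \<phi> (w k) i))\<^sup>2)"
proof -
  have "(\<Sum>j\<in>A. \<phi> j i * \<phi> j h) ^ d
      = (\<Sum>w\<in>{..<d} \<rightarrow>\<^sub>E A. (\<Prod>k<d. \<phi> (w k) i) * (\<Prod>k<d. \<phi> (w k) h))" for i h
    using prod_sum_PiE[of "{..<d}" "\<lambda>_. A" "\<lambda>_ j. \<phi> j i * \<phi> j h"] assms
    by (simp add: prod.distrib)
  then have "(\<Sum>i\<in>I. \<Sum>h\<in>I. a i * a h * (\<Sum>j\<in>A. \<phi> j i * \<phi> j h) ^ d)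
      = (\<Sum>i\<in>I. \<Sum>h\<in>I. \<Sum>w\<in>{..<d} \<rightarrow>\<^sub>E A.
          (a i * (\<Prod>k<d. \<phi> (w k) i)) * (a h * (\<Prod>k<d. \<phi> (w k) h)))"
    by (simp add: sum_distrib_left mult_ac)
  also have "\<dots> = (\<Sum>i\<in>I. \<Sum>w\<in>{..<d} \<rightarrow>\<^sub>E A. \<Sum>h\<in>I.
          (a i * (\<Prod>k<d. \<phi> (w k) i)) * (a h * (\<Prod>k<d. \<phi> (w k) h)))"
    by (intro sum.cong refl sum.swap)
  also have "\<dots> = (\<Sum>w\<in>{..<d} \<rightarrow>\<^sub>E A. \<Sum>i\<in>I. \<Sum>h\<in>I.
          (a i * (\<Prod>k<d. \<phi> (w k) i)) * (a h * (\<Prod>k<d. \<phi> (w k) h)))"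
    by (rule sum.swap)
  finally show ?thesis
    by (simp add: power2_eq_square sum_product)
qed

lemma sum_words_mono:
  fixes q :: "('k \<Rightarrow> 'a) \<Rightarrow> real"
  assumes "finite K" "finite B" "A \<subseteq> B" "\<And>w. q w \<ge> 0"
  shows "sum q (K \<rightarrow>\<^sub>E A) \<le> sum q (K \<rightarrow>\<^sub>E B)"
  using assms by (intro sum_mono2 finite_PiE PiE_mono) auto

text \<open>Words over \<open>A\<close> and words over \<open>B\<close> intersect exactly in the
  words over \<open>A \<inter> B\<close>, whereas their union omits the words over
  \<open>A \<union> B\<close> that mix letters from both differences. The nonnegative weight of
  these mixed words is the surplus.\<close>

lemma sum_words_supermodular:
  fixes q :: "('k \<Rightarrow> 'a) \<Rightarrow> real"
  assumes "finite K" "finite A" "finite B" "\<And>w. q w \<ge> 0"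
  shows "sum q (K \<rightarrow>\<^sub>E A) + sum q (K \<rightarrow>\<^sub>E B) \<le> sum q (K \<rightarrow>\<^sub>E A \<union> B) + sum q (K \<rightarrow>\<^sub>E A \<inter> B)"
proof -
  let ?W = "\<lambda>A. K \<rightarrow>\<^sub>E A"
  have "sum q (?W A) + sum q (?W B) = sum q (?W A \<union> ?W B) + sum q (?W A \<inter> ?W B)"
    using assms by (intro sum.union_inter [symmetric] finite_PiE) auto
  also have "?W A \<inter> ?W B = ?W (A \<inter> B)"
    by (simp add: PiE_Int)
  also have "sum q (?W A \<union> ?W B) \<le> sum q (?W (A \<union> B))"
    using assms by (intro sum_mono2 finite_PiE) (auto simp: PiE_def Pi_def)
  finally show ?thesis by simp
qed

theorem proposition2:
  fixes m n d B :: nat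
    and x :: "nat \<Rightarrow> nat \<Rightarrow> real"
    and y \<alpha> :: "nat \<Rightarrow> real"
    and \<gamma> c lam :: real
    and H F :: "nat set \<Rightarrow> real"
  assumes "m \<ge> 1" and "n \<ge> 1"
    and "\<And>i. i \<in> {1..m} \<Longrightarrow> y i \<in> {-1, 1}"
    and "\<gamma> > 0" and "c \<ge> 0" and "d \<ge> 2" and "B \<in> {1..n}"
    and "lam = (\<Sum>i=1..m. \<Sum>h=1..m. \<alpha> i * \<alpha> h * y i * y h *
                 (c + (\<Sum>j\<in>{1..n}. \<gamma> * x i j * x h j)) ^ d)"
    and "\<And>S. S \<subseteq> {1..n} \<Longrightarrow>
           H S = lam - (\<Sum>i=1..m. \<Sum>h=1..m. \<alpha> i * \<alpha> h * y i * y h *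
                 (c + (\<Sum>j\<in>{1..n} - S. \<gamma> * x i j * x h j)) ^ d)"
    and "F {} = 0"
    and "\<And>S. S \<subseteq> {1..n} \<Longrightarrow> S \<noteq> {} \<Longrightarrow>
           F S = (\<Sum>i=1..m. \<Sum>h=1..m. \<alpha> i * \<alpha> h * y i * y h *
                 (c + (\<Sum>j\<in>S. \<gamma> * x i j * x h j)) ^ d)"
  shows "monotone_nondecreasing_on {1..n} H
    \<and> nonnegative_on {1..n} H
    \<and> submodular_on {1..n} H
    \<and> (\<forall>S''. is_arg_max H (feasible_max n B) S'' \<longrightarrow>
          F ({1..n} - S'') = lam - H S''
        \<and> (card S'' = n - B \<longrightarrow> is_arg_min F (feasible_min n B) ({1..n} - S''))
        \<and> (\<exists>T. S'' \<subseteq> T \<and> card T = n - B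
              \<and> is_arg_max H (feasible_max n B) T
              \<and> is_arg_min F (feasible_min n B) ({1..n} - T)
              \<and> F ({1..n} - T) = lam - H S''))"
proof -
  \<comment> \<open>Features are numbered from 1, so the letter 0 is free to carry the constant. The
    square roots make \<open>\<phi> j i * \<phi> j h\<close> equal to \<open>c\<close> for the
    letter 0 and to \<open>\<gamma> * x i j * x h j\<close> for a feature \<open>j\<close>.\<close>
  define \<phi> where "\<phi> j i = (if j = 0 then sqrt c else sqrt \<gamma> * x i j)" for j i
  define q where "q = (\<lambda>w :: nat \<Rightarrow> nat. (\<Sum>i=1..m. \<alpha> i * y i * (\<Prod>k<d. \<phi> (w k) i))\<^sup>2)"
  \<comment> \<open>\<open>G\<close> is the quadratic form on every set of features, without the
    separate value that \<open>F\<close> takes at the empty set.\<close>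
  define G where "G S = sum q ({..<d} \<rightarrow>\<^sub>E insert 0 S)" for S
  have q_nonneg: "q w \<ge> 0" for w
    by (simp add: q_def)
  have fin: "finite S" if "S \<subseteq> {1..n}" for S
    using that finite_subset by blast
  have G_eq: "(\<Sum>i=1..m. \<Sum>h=1..m. \<alpha> i * \<alpha> h * y i * y h * (c + (\<Sum>j\<in>S. \<gamma> * x i j * x h j)) ^ d) = G S"
    if S: "S \<subseteq> {1..n}" for S
  proof -
    have "c + (\<Sum>j\<in>S. \<gamma> * x i j * x h j) = (\<Sum>j\<in>insert 0 S. \<phi> j i * \<phi> j h)" for i h
    proof -
      have "0 \<notin> S" using S by auto
      moreover have "\<phi> 0 i * \<phi> 0 h = c"
        using \<open>c \<ge> 0\<close> by (simp add: \<phi>_def)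
      moreover have "\<phi> j i * \<phi> j h = \<gamma> * x i j * x h j" if "j \<in> S" for j
      proof -
        have "sqrt \<gamma> * sqrt \<gamma> = \<gamma>" using \<open>\<gamma> > 0\<close> by simp
        moreover have "j \<noteq> 0" using \<open>0 \<notin> S\<close> that by metis
        ultimately show ?thesis by (simp add: \<phi>_def)
      qed
      ultimately show ?thesis using fin[OF S] by simp
    qed
    moreover have "\<alpha> i * \<alpha> h * y i * y h = (\<alpha> i * y i) * (\<alpha> h * y h)" for i h
      by simp
    ultimately show ?thesis
      using quadratic_form_power_eq_sum_squares
          [where A = "insert 0 S" and I = "{1..m}" and a = "\<lambda>i. \<alpha> i * y i" and \<phi> = \<phi> and d = d] fin[OF S]
      by (simp only: G_def q_def) simp
  qed
  have G_mono: "G S \<le> G T" if "S \<subseteq> T" "T \<subseteq> {1..n}" for S T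
    unfolding G_def using that fin q_nonneg by (intro sum_words_mono) auto
  \<comment> \<open>Inserting 0 commutes with union and intersection, so supermodularity in the
    alphabet passes to \<open>S\<close>.\<close>
  have G_super: "G S + G T \<le> G (S \<union> T) + G (S \<inter> T)" if "S \<subseteq> {1..n}" "T \<subseteq> {1..n}" for S T
    using sum_words_supermodular[of "{..<d}" "insert 0 S" "insert 0 T" q] that fin q_nonneg
    by (simp add: G_def)
  have lam: "lam = G {1..n}"
    using assms(8) G_eq[of "{1..n}"] by simp
  have H: "H S = lam - G ({1..n} - S)" if "S \<subseteq> {1..n}" for S
    using assms(9)[OF that] G_eq[of "{1..n} - S"] by simp
  have F: "F S = G S" if "S \<subseteq> {1..n}" "S \<noteq> {}" for S
    using assms(11)[OF that] G_eq[of S] that by simp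
  have H_mono: "H S \<le> H T" if "S \<subseteq> T" "T \<subseteq> {1..n}" for S T
    using H[of S] H[of T] G_mono[of "{1..n} - T" "{1..n} - S"] that by auto
  have "monotone_nondecreasing_on {1..n} H"
    unfolding monotone_nondecreasing_on_def by (auto intro!: H_mono)
  moreover have "nonnegative_on {1..n} H"
    unfolding nonnegative_on_def using H lam G_mono by auto
  moreover have "submodular_on {1..n} H"
    unfolding submodular_on_def
  proof (intro allI impI, elim conjE)
    fix S T assume ST: "S \<subseteq> {1..n}" "T \<subseteq> {1..n}"
    have "H (S \<union> T) = lam - G (({1..n} - S) \<inter> ({1..n} - T))"
      using H[of "S \<union> T"] ST by (simp add: Diff_Un)
    moreover have "H (S \<inter> T) = lam - G (({1..n} - S) \<union> ({1..n} - T))"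
      using H[of "S \<inter> T"] ST by (simp add: Diff_Int le_infI1)
    ultimately show "H (S \<union> T) + H (S \<inter> T) \<le> H S + H T"
      using G_super[of "{1..n} - S" "{1..n} - T"] H[OF ST(1)] H[OF ST(2)] by simp
  qed
  \<comment> \<open>Since \<open>B \<ge> 1\<close>, a feasible \<open>S\<close> has fewer than
    \<open>n\<close> elements; its complement is nonempty, where \<open>F\<close> agrees with
    \<open>G\<close>.\<close>
  moreover have F_compl: "F ({1..n} - S) = lam - H S" if "feasible_max n B S" for S
  proof -
    have S: "S \<subseteq> {1..n}" "card S < n"
      using that \<open>B \<in> {1..n}\<close> by (auto simp: feasible_max_def)
    then have "{1..n} - S \<noteq> {}"
      using card_mono[OF fin[OF S(1)], of "{1..n}"] by auto
    then show ?thesis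
      using F[of "{1..n} - S"] H[OF S(1)] by simp
  qed
  moreover have arg_min: "is_arg_min F (feasible_min n B) ({1..n} - S)"
    if S: "is_arg_max H (feasible_max n B) S" and card_S: "card S = n - B" for S
  proof -
    have feas: "feasible_max n B S"
      using S by (simp add: is_arg_max_def)
    then have "feasible_min n B ({1..n} - S)"
      using card_S \<open>B \<in> {1..n}\<close> by (auto simp: feasible_max_def feasible_min_def card_Diff_subset fin)
    \<comment> \<open>The complement of a competitor \<open>U\<close> is feasible for the
      maximization, so optimality of \<open>S\<close> bounds its value under
      \<open>H\<close>.\<close>
    moreover have "F ({1..n} - S) \<le> F U" if U: "feasible_min n B U" for U
    proof -
      have "feasible_max n B ({1..n} - U)"
        using U by (auto simp: feasible_max_def feasible_min_def card_Diff_subset fin)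
      moreover from this have "F U = lam - H ({1..n} - U)"
        using F_compl[of "{1..n} - U"] U by (simp add: feasible_min_def double_diff)
      ultimately show ?thesis
        using S F_compl[OF feas] by (force simp: is_arg_max_def not_less)
    qed
    ultimately show ?thesis
      by (simp add: is_arg_min_linorder)
  qed
  \<comment> \<open>A maximizer may have fewer than \<open>n - B\<close> elements, and then its
    complement is too large for the minimization. It is padded to size \<open>n - B\<close>;
    monotonicity and optimality together keep the value of \<open>H\<close> unchanged.\<close>
  moreover have "\<exists>T. S \<subseteq> T \<and> card T = n - B \<and> is_arg_max H (feasible_max n B) T
      \<and> is_arg_min F (feasible_min n B) ({1..n} - T) \<and> F ({1..n} - T) = lam - H S"
    if S: "is_arg_max H (feasible_max n B) S" for S
  proof -
    have "S \<subseteq> {1..n}" "card S \<le> n - B"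
      using S by (auto simp: is_arg_max_def feasible_max_def)
    then obtain T where T: "S \<subseteq> T" "T \<subseteq> {1..n}" "card T = n - B"
      using exists_subset_between[of S "n - B" "{1..n}"] by auto
    then have feas: "feasible_max n B T"
      by (simp add: feasible_max_def)
    then have "H T = H S"
      using H_mono[OF T(1,2)] S by (auto simp: is_arg_max_def)
    then have "is_arg_max H (feasible_max n B) T"
      using S feas by (simp add: is_arg_max_def)
    then show ?thesis
      using T arg_min F_compl[OF feas] \<open>H T = H S\<close> by metis
  qed
  ultimately show ?thesis
    by (auto simp: is_arg_max_def)
qed

end
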